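(* Any randomized one-pass streaming algorithm that approximates the length of the longest palindrome of an input stream of length $n$ up to an additive error of $\varepsilon\sqrt n$ must use $\Omega(\sqrt n/\varepsilon)$ space.
   Context: Streaming model: the input is a string $S=S[1]\cdots S[n]$ over an alphabet $\Sigma\subset\mathbb N$, read once from left to right. A palindrome is a substring that reads the same forwards and backwards; the algorithm must output an estimate of the length of a longest palindromic substring of $S$ that differs from the true value by at most the stated additive error. Space is measured in memory cells, each able to store one symbol of $\Sigma$.
   Formalization: The alphabet is fixed, finite, with at least two symbols (the hidden constant may depend on it); the additive error is at least 1, i.e. ε ≥ 1/√n; success probability is a constant above 1/2; without these limits the bound fails. *)

theory Defs
  imports "HOL-Probability.Probability" "HOL-Library.Sublist"
begin

text \<open>Length of a longest palindromic substring (\<^const>\<open>sublist\<close> is the contiguous notion).\<close>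

definition lps :: "nat list \<Rightarrow> nat" where
  "lps S = Max {length u | u. sublist u S \<and> rev u = u}"

text \<open>
  A deterministic one-pass streaming algorithm: the only thing carried from one symbol to the
  next is the content of the memory cells, given as a list of symbols.  The update may
  depend on the number of symbols read so far, i.e. a clock is available at no cost in space, and
  the work done within one update is not charged.  As there is no uniformity condition, there may
  be a different algorithm for every input length.
\<close>

record stream_alg =
  start :: "nat list"
  step :: "nat \<Rightarrow> nat list \<Rightarrow> nat \<Rightarrow> nat list"
  answer :: "nat list \<Rightarrow> real"

primrec run_from :: "stream_alg \<Rightarrow> nat \<Rightarrow> nat list \<Rightarrow> nat list \<Rightarrow> nat list" where
  "run_from A t m [] = m"
| "run_from A t m (a # w) = run_from A (Suc t) (step A t m a) w"

definition estimate :: "stream_alg \<Rightarrow> nat list \<Rightarrow> real" where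
  "estimate A S = answer A (run_from A 0 (start A) S)"

definition memory :: "nat set \<Rightarrow> nat \<Rightarrow> nat list set" where
  "memory \<Sigma> s = {m. length m = s \<and> set m \<subseteq> \<Sigma>}"

definition uses_cells :: "nat set \<Rightarrow> nat \<Rightarrow> stream_alg \<Rightarrow> bool" where
  "uses_cells \<Sigma> s A \<longleftrightarrow>
     start A \<in> memory \<Sigma> s \<and>
     (\<forall>t. \<forall>m\<in>memory \<Sigma> s. \<forall>a\<in>\<Sigma>. step A t m a \<in> memory \<Sigma> s)"

text \<open>
  A randomized algorithm is a probability distribution over deterministic ones.  Neither the random
  bits nor access to them is charged as space.  Because the update depends on the time, this
  includes algorithms that draw fresh random bits at every step.
\<close>

definition randomized_alg :: "nat set \<Rightarrow> nat \<Rightarrow> stream_alg measure \<Rightarrow> bool" where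
  "randomized_alg \<Sigma> s R \<longleftrightarrow> prob_space R \<and> (\<forall>A\<in>space R. uses_cells \<Sigma> s A)"

text \<open>
  On every input of length \<open>n\<close> the additive error is at most \<open>E\<close> with probability at least \<open>p\<close>.
  For \<open>p > 0\<close> this entails that the success events are measurable, since \<^const>\<open>measure\<close> is 0 on
  non-measurable sets.
\<close>

definition approximates_lps ::
  "nat set \<Rightarrow> nat \<Rightarrow> real \<Rightarrow> real \<Rightarrow> stream_alg measure \<Rightarrow> bool" where
  "approximates_lps \<Sigma> n E p R \<longleftrightarrow>
     (\<forall>S. length S = n \<and> set S \<subseteq> \<Sigma> \<longrightarrow>
        measure R {A \<in> space R. \<bar>estimate A S - real (lps S)\<bar> \<le> E} \<ge> p)"

end

theory Submission
  imports Defs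
begin

text \<open>
  The proof is a reduction from augmented indexing.  Let \<open>E = \<epsilon> \<surd>n\<close>, \<open>L = \<lfloor>E\<rfloor> + 1\<close> and encode a bit string \<open>x\<close> of
  length \<open>m\<close> of order \<open>n / E\<close> by a word \<open>U\<close> that starts with \<open>b\<close> and represents each bit by \<open>a\<^sup>L\<close> or \<open>b\<^sup>L\<close>.  In a stream
  \<open>rev U \<cdot> a\<^sup>N \<cdot> V\<close> with \<open>N\<close> at least twice the length of \<open>U\<close> and \<open>V\<close>, both of which start
  with \<open>b\<close>, every palindrome longer than \<open>N\<close> is centred at the centre of \<open>a\<^sup>N\<close>, so the longest one has length \<open>N\<close> plus twice
  the length of the longest common prefix of \<open>U\<close> and \<open>V\<close>.  If \<open>V\<close> encodes the first \<open>i\<close> bits of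
  \<open>x\<close> followed by the bit 1, then the two values of bit \<open>i\<close> of \<open>x\<close> lead to lengths that differ by
  more than \<open>2 E\<close>, so a successful run predicts bit \<open>i\<close> from the memory content after \<open>rev U\<close> and the
  earlier bits.

  For a fixed memory content, the map from \<open>x\<close> to the set of wrongly predicted positions is a bijection onto
  the subsets of \<open>{..<m}\<close>.  So the sum of \<open>\<theta>\<close> to the number of wrong predictions, over all \<open>x\<close>, is \<open>(1 + \<theta>)\<^sup>m\<close>.
  Some deterministic algorithm in the support predicts wrongly at most \<open>(1 - p) m\<close> positions on average, so by
  convexity the number of memory contents is at least \<open>(2 \<theta> powr (1 - p) / (1 + \<theta>))\<^sup>m\<close>, and the
  base exceeds 1 for some \<open>\<theta> < 1\<close> because \<open>p > 1 / 2\<close>.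
\<close>

section \<open>Palindromes around a long run\<close>

lemma finite_palindromic_sublist_lengths: "finite {length u | u. sublist u S \<and> rev u = u}"
proof (rule finite_subset)
  show "{length u | u. sublist u S \<and> rev u = u} \<subseteq> {..length S}"
  proof
    fix k assume "k \<in> {length u | u. sublist u S \<and> rev u = u}"
    then obtain u where "k = length u" "sublist u S" by blast
    then show "k \<in> {..length S}" using sublist_length_le[of u S] by simp
  qed
qed simp

lemma length_le_lps:
  assumes "sublist u S" "rev u = u"
  shows "length u \<le> lps S"
proof -
  have "length u \<in> {length u | u. sublist u S \<and> rev u = u}" using assms by blast
  then show ?thesis unfolding lps_def by (rule Max_ge[OF finite_palindromic_sublist_lengths])
qed

lemma lps_le:
  assumes "\<And>u. sublist u S \<Longrightarrow> rev u = u \<Longrightarrow> length u \<le> B"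
  shows "lps S \<le> B"
  unfolding lps_def
proof (rule Max.boundedI[OF finite_palindromic_sublist_lengths])
  have "length ([] :: nat list) \<in> {length u | u. sublist u S \<and> rev u = u}"
    by (intro CollectI exI[of _ "[]"]) simp
  then show "{length u | u. sublist u S \<and> rev u = u} \<noteq> {}" by (metis empty_iff)
next
  fix k assume "k \<in> {length u | u. sublist u S \<and> rev u = u}"
  then obtain u where "k = length u" "sublist u S" "rev u = u" by blast
  then show "k \<le> B" using assms by blast
qed

text \<open>Off-centre, so long a palindrome would reflect a letter bordering the run into the run,
  since \<open>2 * P \<le> N\<close>; centred on the run, it would contain the mismatched
  pair.\<close>

lemma palindromic_sublist_length_le:
  assumes len: "length S = 2 * P + N" and "2 * P \<le> N" and "\<delta> < P"
    and left: "S ! (P - 1) \<noteq> z" and right: "S ! (P + N) \<noteq> z"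
    and run: "\<And>q. P \<le> q \<Longrightarrow> q < P + N \<Longrightarrow> S ! q = z"
    and mismatch: "S ! (P + N + \<delta>) \<noteq> S ! (P - 1 - \<delta>)"
    and "sublist u S" "rev u = u"
  shows "length u \<le> N + 2 * \<delta>"
proof (rule ccontr)
  assume long: "\<not> length u \<le> N + 2 * \<delta>"
  obtain ps ss where S: "S = ps @ u @ ss"
    using \<open>sublist u S\<close> by (auto simp: sublist_def)
  define l where "l = length ps"
  define k where "k = length u"
  have lk: "l + k \<le> 2 * P + N" using len by (simp add: S l_def k_def)
  have k: "k > N + 2 * \<delta>" using long by (simp add: k_def)
  have mirror: "S ! q = S ! (2 * l + k - 1 - q)" if "l \<le> q" "q < l + k" for q
  proof -
    have 1: "S ! (l + j) = u ! j" if "j < k" for j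
      using that by (simp add: S l_def k_def nth_append)
    have "u ! (q - l) = u ! (k - 1 - (q - l))"
      using that rev_nth[of "q - l" u] \<open>rev u = u\<close> by (simp add: k_def)
    moreover have "l + (k - 1 - (q - l)) = 2 * l + k - 1 - q" using that by simp
    ultimately show ?thesis
      using 1[of "q - l"] 1[of "k - 1 - (q - l)"] that by simp
  qed
  \<comment> \<open>\<open>2 * l + k - 1\<close> is the sum of two mirrored positions, hence twice
    the centre of \<open>u\<close>; \<open>2 * P + N - 1\<close> is twice the centre of the
    run.\<close>
  consider "2 * l + k - 1 = 2 * P + N - 1" | "2 * l + k - 1 < 2 * P + N - 1"
    | "2 * l + k - 1 > 2 * P + N - 1" by linarith
  then show False
  proof cases
    case 1
    have "S ! (P + N + \<delta>) = S ! (2 * l + k - 1 - (P + N + \<delta>))"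
      by (rule mirror) (use 1 k \<open>\<delta> < P\<close> in linarith)+
    moreover have "2 * l + k - 1 - (P + N + \<delta>) = P - 1 - \<delta>" using 1 by linarith
    ultimately show False using mismatch by simp
  next
    case 2
    have "S ! (P - 1) = S ! (2 * l + k - 1 - (P - 1))"
      by (rule mirror) (use 2 k \<open>\<delta> < P\<close> \<open>2 * P \<le> N\<close> in linarith)+
    also have "\<dots> = z"
      by (rule run) (use 2 k \<open>\<delta> < P\<close> \<open>2 * P \<le> N\<close> in linarith)+
    finally show False using left by simp
  next
    case 3
    have "S ! (P + N) = S ! (2 * l + k - 1 - (P + N))"
      by (rule mirror) (use 3 k lk \<open>\<delta> < P\<close> \<open>2 * P \<le> N\<close> in linarith)+
    also have "\<dots> = z"
      by (rule run) (use 3 k lk \<open>\<delta> < P\<close> \<open>2 * P \<le> N\<close> in linarith)+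
    finally show False using right by simp
  qed
qed

lemma lps_around_run_le:
  assumes "length U = P" "length V = P" "2 * P \<le> N" "\<delta> < P"
    and "U ! 0 \<noteq> z" "V ! 0 \<noteq> z" "U ! \<delta> \<noteq> V ! \<delta>"
  shows "lps (rev U @ replicate N z @ V) \<le> N + 2 * \<delta>"
proof (rule lps_le, rule palindromic_sublist_length_le)
  show "length (rev U @ replicate N z @ V) = 2 * P + N" using assms by simp
  show "(rev U @ replicate N z @ V) ! (P - 1) \<noteq> z"
    using assms by (simp add: nth_append rev_nth)
  show "(rev U @ replicate N z @ V) ! (P + N) \<noteq> z"
    using assms by (simp add: nth_append)
  show "(rev U @ replicate N z @ V) ! q = z" if "P \<le> q" "q < P + N" for q
    using that assms by (auto simp: nth_append)
  have "P - Suc (P - 1 - \<delta>) = \<delta>" using assms by simp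
  then show "(rev U @ replicate N z @ V) ! (P + N + \<delta>) \<noteq> (rev U @ replicate N z @ V) ! (P - 1 - \<delta>)"
    using assms by (simp add: nth_append rev_nth)
qed (use assms in auto)

lemma lps_around_run_ge:
  assumes "prefix w U" "prefix w V"
  shows "N + 2 * length w \<le> lps (rev U @ replicate N z @ V)"
proof -
  obtain u v where "U = w @ u" "V = w @ v" using assms by (auto simp: prefix_def)
  then have "rev U @ replicate N z @ V = rev u @ (rev w @ replicate N z @ w) @ v" by simp
  then have "sublist (rev w @ replicate N z @ w) (rev U @ replicate N z @ V)"
    by (metis sublist_appendI)
  from length_le_lps[OF this] show ?thesis by simp
qed

section \<open>Augmented indexing\<close>

definition mispredictions :: "('a list \<Rightarrow> 'a) \<Rightarrow> 'a list \<Rightarrow> nat set" where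
  "mispredictions g x = {i. i < length x \<and> g (take i x) \<noteq> x ! i}"

lemma finite_mispredictions [simp]: "finite (mispredictions g x)"
  by (simp add: mispredictions_def)

lemma card_mispredictions_snoc:
  "card (mispredictions g (x @ [t])) = card (mispredictions g x) + (if g x = t then 0 else 1)"
proof -
  have "mispredictions g (x @ [t]) = mispredictions g x \<union> (if g x = t then {} else {length x})"
    by (auto simp: mispredictions_def nth_append less_Suc_eq split: if_splits)
  moreover have "length x \<notin> mispredictions g x" by (simp add: mispredictions_def)
  ultimately show ?thesis by simp
qed

lemma bool_lists_Suc:
  "{x :: bool list. length x = Suc m} = (\<lambda>(x, t). x @ [t]) ` ({x. length x = m} \<times> UNIV)"
  by (force simp: length_Suc_conv_rev)

lemma finite_bool_lists [simp]: "finite {x :: bool list. length x = m}"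
  using finite_lists_length_eq[of "UNIV :: bool set" m] by simp

lemma card_bool_lists: "card {x :: bool list. length x = m} = 2 ^ m"
  using card_lists_length_eq[of "UNIV :: bool set" m] by simp

text \<open>Whatever \<open>g\<close> predicts from a prefix, exactly one of the two next bits
  contradicts it, so each position contributes a factor \<open>1 + \<theta>\<close>.\<close>

lemma sum_power_mispredictions:
  fixes \<theta> :: real and g :: "bool list \<Rightarrow> bool"
  shows "(\<Sum>x | length x = m. \<theta> ^ card (mispredictions g x)) = (1 + \<theta>) ^ m"
proof (induction m)
  case 0
  then show ?case by (simp add: mispredictions_def)
next
  case (Suc m)
  have "inj_on (\<lambda>(x, t). x @ [t]) ({x :: bool list. length x = m} \<times> UNIV)"
    by (auto simp: inj_on_def)
  then have "(\<Sum>x | length x = Suc m. \<theta> ^ card (mispredictions g x))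
      = (\<Sum>(x, t)\<in>{x. length x = m} \<times> UNIV. \<theta> ^ card (mispredictions g (x @ [t])))"
    unfolding bool_lists_Suc by (subst sum.reindex) (auto simp: case_prod_unfold)
  also have "\<dots> = (\<Sum>x | length x = m. \<Sum>t\<in>UNIV. \<theta> ^ card (mispredictions g (x @ [t])))"
    by (subst sum.cartesian_product) simp
  also have "\<dots> = (\<Sum>x | length x = m. \<theta> ^ card (mispredictions g x) * (1 + \<theta>))"
    by (intro sum.cong) (auto simp: UNIV_bool card_mispredictions_snoc algebra_simps)
  finally show ?case using Suc by (simp flip: sum_distrib_right)
qed

lemma augmented_indexing_bound:
  fixes u z :: real and f :: "bool list \<Rightarrow> 'm" and g :: "'m \<Rightarrow> bool list \<Rightarrow> bool"
  assumes "finite M" and f: "\<And>x. length x = m \<Longrightarrow> f x \<in> M" and "u \<ge> 0"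
    and avg: "(\<Sum>x | length x = m. real (card (mispredictions (g (f x)) x))) \<le> z * 2 ^ m"
  shows "2 ^ m * exp (- u * z) \<le> card M * (1 + exp (- u)) ^ m"
proof -
  let ?X = "{x :: bool list. length x = m}"
  let ?e = "\<lambda>x. real (card (mispredictions (g (f x)) x))"
  \<comment> \<open>The tangent of the convex function \<open>exp (- u * e)\<close> at
    \<open>e = z\<close>; summing it over all \<open>x\<close> gives Jensen's inequality.\<close>
  have tangent: "(1 - u * (?e x - z)) * exp (- u * z) \<le> exp (- u) ^ card (mispredictions (g (f x)) x)" for x
  proof -
    have "(1 - u * (?e x - z)) * exp (- u * z) \<le> exp (- u * (?e x - z)) * exp (- u * z)"
      using exp_ge_add_one_self[of "- u * (?e x - z)"] by (intro mult_right_mono) auto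
    also have "\<dots> = exp (?e x * (- u))" by (simp add: algebra_simps flip: exp_add)
    finally show ?thesis by (simp only: exp_of_nat_mult)
  qed
  have "u * (\<Sum>x\<in>?X. ?e x) \<le> u * (z * 2 ^ m)" using avg \<open>u \<ge> 0\<close> by (rule mult_left_mono)
  moreover have "(\<Sum>x\<in>?X. 1 - u * (?e x - z)) = 2 ^ m + u * (z * 2 ^ m) - u * (\<Sum>x\<in>?X. ?e x)"
    by (simp add: sum_subtractf sum.distrib sum_distrib_left card_bool_lists algebra_simps)
  ultimately have "2 ^ m \<le> (\<Sum>x\<in>?X. 1 - u * (?e x - z))" by linarith
  then have "2 ^ m * exp (- u * z) \<le> (\<Sum>x\<in>?X. 1 - u * (?e x - z)) * exp (- u * z)"
    by (rule mult_right_mono) simp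
  also have "\<dots> = (\<Sum>x\<in>?X. (1 - u * (?e x - z)) * exp (- u * z))"
    by (rule sum_distrib_right)
  also have "\<dots> \<le> (\<Sum>x\<in>?X. exp (- u) ^ card (mispredictions (g (f x)) x))"
    by (intro sum_mono tangent)
  \<comment> \<open>The actual memory content \<open>f x\<close> is replaced by a sum over all
    contents, which no longer depends on \<open>x\<close>.\<close>
  also have "\<dots> \<le> (\<Sum>x\<in>?X. \<Sum>\<sigma>\<in>M. exp (- u) ^ card (mispredictions (g \<sigma>) x))"
    using f \<open>finite M\<close>
    by (intro sum_mono member_le_sum[where f = "\<lambda>\<sigma>. exp (- u) ^ card (mispredictions (g \<sigma>) _)"]) auto
  also have "\<dots> = (\<Sum>\<sigma>\<in>M. \<Sum>x\<in>?X. exp (- u) ^ card (mispredictions (g \<sigma>) x))"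
    by (rule sum.swap)
  also have "\<dots> = card M * (1 + exp (- u)) ^ m"
    by (simp add: sum_power_mispredictions)
  finally show ?thesis .
qed

text \<open>The expression vanishes at \<open>u = 0\<close> and has derivative
  \<open>p - 1 / 2\<close> there.\<close>

lemma ex_positive_rate:
  fixes p :: real
  assumes "p > 1 / 2"
  shows "\<exists>u>0. 0 < ln 2 - ln (1 + exp (- u)) - u * (1 - p)"
proof -
  let ?h = "\<lambda>u. ln 2 - ln (1 + exp (- u)) - u * (1 - p)"
  have "DERIV ?h 0 :> p - 1 / 2"
    by (auto intro!: derivative_eq_intros simp: field_simps)
  then obtain d where d: "d > 0" "\<And>h. 0 < h \<Longrightarrow> h < d \<Longrightarrow> ?h 0 < ?h (0 + h)"
    using DERIV_pos_inc_right[of ?h "p - 1 / 2" 0] assms by auto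
  have "?h 0 < ?h (0 + d / 2)" using d(1) by (intro d(2)) auto
  moreover have "?h 0 = 0" by simp
  ultimately have "0 < ?h (d / 2)" by (simp only: add_0)
  then show ?thesis using d(1) by (intro exI[of _ "d / 2"] conjI) auto
qed

text \<open>The expected number of events that occur is at least \<open>p * card I\<close>, so some
  outcome attains it. This fixes the random choices.\<close>

lemma (in prob_space) ex_many_events:
  assumes "finite I" and "p > 0" and B: "\<And>i. i \<in> I \<Longrightarrow> prob (B i) \<ge> p"
  shows "\<exists>\<omega>\<in>space M. p * card I \<le> card {i \<in> I. \<omega> \<in> B i}"
proof (rule ccontr)
  assume "\<not> ?thesis"
  then have less: "real (card {i \<in> I. \<omega> \<in> B i}) < p * card I" if "\<omega> \<in> space M" for \<omega>
    using that by force
  have ev: "B i \<in> events" if "i \<in> I" for i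
    using B[OF that] \<open>p > 0\<close> measure_notin_sets[of "B i" M] by force
  have count: "real (card {i \<in> I. \<omega> \<in> B i}) = (\<Sum>i\<in>I. indicator (B i) \<omega>)" for \<omega>
    using \<open>finite I\<close> by (simp add: indicator_def sum.If_cases Int_def)
  have int: "integrable M (\<lambda>\<omega>. \<Sum>i\<in>I. indicator (B i) \<omega> :: real)"
    using ev by (intro Bochner_Integration.integrable_sum integrable_real_indicator) (auto simp: emeasure_eq_measure)
  have "p * card I \<le> (\<Sum>i\<in>I. prob (B i))"
    using sum_bounded_below[of I p "\<lambda>i. prob (B i)"] B by (simp add: mult.commute)
  also have "\<dots> = expectation (\<lambda>\<omega>. \<Sum>i\<in>I. indicator (B i) \<omega>)"
    using ev by (subst Bochner_Integration.integral_sum)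
      (auto intro!: integrable_real_indicator sum.cong simp: emeasure_eq_measure Int_absorb2 sets.sets_into_space)
  also have "\<dots> < p * card I"
    using int less by (intro expectation_less) (auto simp flip: count)
  finally show False by simp
qed

section \<open>Streaming algorithms\<close>

lemma run_from_append:
  "run_from A t m (v @ w) = run_from A (t + length v) (run_from A t m v) w"
  by (induction v arbitrary: t m) auto

lemma run_from_in_memory:
  "uses_cells \<Sigma> s A \<Longrightarrow> m \<in> memory \<Sigma> s \<Longrightarrow> set w \<subseteq> \<Sigma> \<Longrightarrow> run_from A t m w \<in> memory \<Sigma> s"
  by (induction w arbitrary: t m) (auto simp: uses_cells_def)

lemma finite_memory: "finite \<Sigma> \<Longrightarrow> finite (memory \<Sigma> s)"
  using finite_lists_length_eq[of \<Sigma> s] by (simp add: memory_def conj_commute)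

lemma card_memory: "finite \<Sigma> \<Longrightarrow> card (memory \<Sigma> s) = card \<Sigma> ^ s"
  using card_lists_length_eq[of \<Sigma> s] by (simp add: memory_def conj_commute)

section \<open>Hard input streams\<close>

text \<open>The leading \<open>b\<close> keeps the code from extending the adjacent run of
  \<open>a\<close>.\<close>

definition block_code :: "nat \<Rightarrow> nat \<Rightarrow> nat \<Rightarrow> bool list \<Rightarrow> nat list" where
  "block_code a b L x = b # concat (map (\<lambda>t. replicate L (if t then a else b)) x)"

lemma length_block_code [simp]: "length (block_code a b L x) = Suc (length x * L)"
  by (induction x) (auto simp: block_code_def)

lemma block_code_append:
  "block_code a b L (x @ y) = block_code a b L x @ tl (block_code a b L y)"
  by (simp add: block_code_def)

lemma set_block_code: "set (block_code a b L x) \<subseteq> {a, b}"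
  by (auto simp: block_code_def)

lemma nth_0_block_code [simp]: "block_code a b L x ! 0 = b"
  by (simp add: block_code_def)

text \<open>For \<open>length y < m\<close>, the first \<open>L\<close> appended letters encode the
  guess that the next bit is \<open>True\<close>; the rest is padding.\<close>

definition query_word :: "nat \<Rightarrow> nat \<Rightarrow> nat \<Rightarrow> nat \<Rightarrow> bool list \<Rightarrow> nat list" where
  "query_word a b L m y = block_code a b L y @ replicate ((m - length y) * L) a"

lemma length_query_word:
  "length y \<le> m \<Longrightarrow> length (query_word a b L m y) = Suc (m * L)"
  by (simp add: query_word_def flip: add_mult_distrib)

text \<open>Block \<open>i\<close> is \<open>b\<close> in the code and \<open>a\<close> in the
  query, so they differ at its first position, \<open>Suc (i * L)\<close>.\<close>

lemma lps_query_le: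
  assumes "a \<noteq> b" "L > 0" "2 * Suc (length x * L) \<le> N" "i < length x" "\<not> x ! i"
  shows "lps (rev (block_code a b L x) @ replicate N a @ query_word a b L (length x) (take i x))
    \<le> N + 2 * Suc (i * L)"
proof (rule lps_around_run_le[where P = "Suc (length x * L)"])
  have x: "x = take i x @ [False] @ drop (Suc i) x"
    using assms id_take_nth_drop[of i x] by simp
  have "tl (block_code a b L (False # y)) ! 0 = b" for y
    using \<open>L > 0\<close> by (simp add: block_code_def nth_append)
  then have "block_code a b L x ! Suc (i * L) = b"
    using assms by (subst x, subst block_code_append) (simp add: nth_append)
  moreover have "query_word a b L (length x) (take i x) ! Suc (i * L) = a"
    using assms by (simp add: query_word_def nth_append)
  ultimately show "block_code a b L x ! Suc (i * L)
      \<noteq> query_word a b L (length x) (take i x) ! Suc (i * L)"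
    using \<open>a \<noteq> b\<close> by simp
  show "query_word a b L (length x) (take i x) ! 0 \<noteq> a"
    using assms by (simp add: query_word_def nth_append)
qed (use assms in \<open>auto simp: length_query_word\<close>)

text \<open>The code and the query agree up to the end of block \<open>i\<close>.\<close>

lemma lps_query_ge:
  assumes "i < length x" "x ! i"
  shows "N + 2 * Suc (i * L) + 2 * L
    \<le> lps (rev (block_code a b L x) @ replicate N a @ query_word a b L (length x) (take i x))"
proof -
  let ?w = "block_code a b L (take i x) @ replicate L a"
  have x: "x = take i x @ [True] @ drop (Suc i) x"
    using assms id_take_nth_drop[of i x] by simp
  have "prefix ?w (block_code a b L x)"
    by (subst (2) x, subst block_code_append) (simp add: block_code_def)
  moreover have "prefix ?w (query_word a b L (length x) (take i x))"
  proof -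
    have "(length x - i) * L = L + (length x - Suc i) * L"
      using assms by (metis Suc_diff_Suc mult_Suc)
    then show ?thesis using assms by (simp add: query_word_def replicate_add)
  qed
  ultimately have "N + 2 * length ?w
      \<le> lps (rev (block_code a b L x) @ replicate N a @ query_word a b L (length x) (take i x))"
    by (rule lps_around_run_ge)
  then show ?thesis using assms by simp
qed

lemma cells_lower_bound:
  fixes E p u :: real
  assumes "finite \<Sigma>" "a \<in> \<Sigma>" "b \<in> \<Sigma>" "a \<noteq> b" and "p > 0" "u > 0" and "E < L"
    and n: "4 * Suc (m * L) \<le> n"
    and R: "randomized_alg \<Sigma> s R" "approximates_lps \<Sigma> n E p R"
  shows "m * (ln 2 - ln (1 + exp (- u)) - u * (1 - p)) \<le> s * ln (card \<Sigma>)"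
proof -
  interpret prob_space R using R by (simp add: randomized_alg_def)
  \<comment> \<open>The run fills the stream up to length exactly \<open>n\<close>.\<close>
  define N where "N = n - 2 * Suc (m * L)"
  have N: "2 * Suc (m * L) \<le> N" using n by (simp add: N_def)
  define X where "X = {x :: bool list. length x = m}"
  define I where "I = X \<times> {..<m}"
  have fin: "finite X" "finite I" by (auto simp: X_def I_def)
  have card: "card X = 2 ^ m" "card I = 2 ^ m * m"
    by (auto simp: X_def I_def card_bool_lists card_cartesian_product)
  define S where "S x i = rev (block_code a b L x) @ replicate N a @ query_word a b L m (take i x)" for x i
  define B where "B = (\<lambda>(x, i). {A \<in> space R. \<bar>estimate A (S x i) - real (lps (S x i))\<bar> \<le> E})"
  have prob_B: "prob (B j) \<ge> p" if "j \<in> I" for j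
  proof -
    obtain x i where j: "j = (x, i)" "length x = m" "i < m"
      using \<open>j \<in> I\<close> by (auto simp: I_def X_def)
    have "set (S x i) \<subseteq> \<Sigma>"
      using set_block_code[of a b L] assms by (fastforce simp: S_def query_word_def)
    moreover have "length (S x i) = n"
    proof -
      have "length (S x i) = 2 * Suc (m * L) + N"
        using j by (simp add: S_def length_query_word)
      then show ?thesis using n unfolding N_def by linarith
    qed
    ultimately show ?thesis using R(2) by (simp add: approximates_lps_def B_def j)
  qed
  obtain A where A: "A \<in> space R" "p * card I \<le> card {j \<in> I. A \<in> B j}"
    using ex_many_events[where B = B, OF fin(2) \<open>p > 0\<close> prob_B] by blast
  have uses: "uses_cells \<Sigma> s A" using R(1) A by (simp add: randomized_alg_def)
  define f where "f x = run_from A 0 (start A) (rev (block_code a b L x))" for x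
  \<comment> \<open>The threshold separates the cases: a successful estimate is at most this value
    for bit \<open>False\<close>, and at least \<open>2 * L - 2 * E > 0\<close> above it for bit
    \<open>True\<close>.\<close>
  define g where "g \<sigma> y \<longleftrightarrow> answer A (run_from A (Suc (m * L)) \<sigma> (replicate N a @ query_word a b L m y))
      > N + 2 * Suc (length y * L) + E" for \<sigma> y
  have f: "f x \<in> memory \<Sigma> s" for x
    unfolding f_def using set_block_code[of a b L x] assms uses
    by (intro run_from_in_memory) (auto simp: uses_cells_def)
  have correct: "g (f x) (take i x) = x ! i" if "(x, i) \<in> I" "A \<in> B (x, i)" for x i
  proof -
    have x: "length x = m" "i < m" using that by (auto simp: I_def X_def)
    have est: "estimate A (S x i)
        = answer A (run_from A (Suc (m * L)) (f x) (replicate N a @ query_word a b L m (take i x)))"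
      using x by (simp add: estimate_def S_def f_def run_from_append)
    have err: "\<bar>estimate A (S x i) - real (lps (S x i))\<bar> \<le> E" using that by (simp add: B_def)
    show ?thesis
    proof (cases "x ! i")
      case True
      have "real (N + 2 * Suc (i * L) + 2 * L) \<le> real (lps (S x i))"
        using lps_query_ge[of i x N L a b] True x unfolding S_def of_nat_le_iff by simp
      then show ?thesis using est err True x \<open>E < L\<close> by (simp add: g_def)
    next
      case False
      have "L > 0" using err \<open>E < L\<close> by (cases "L = 0") auto
      then have "real (lps (S x i)) \<le> real (N + 2 * Suc (i * L))"
        using lps_query_le[of a b L x N i] False x N assms unfolding S_def of_nat_le_iff
        by simp
      then show ?thesis using est err False x by (simp add: g_def)
    qed
  qed
  \<comment> \<open>Every misprediction is a pair on which \<open>A\<close> fails, and at most a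
    fraction \<open>1 - p\<close> of the pairs are such.\<close>
  let ?bad = "SIGMA x:X. mispredictions (g (f x)) x"
  have "?bad \<subseteq> I - {j \<in> I. A \<in> B j}"
    using correct by (auto simp: I_def X_def mispredictions_def)
  then have "card ?bad \<le> card I - card {j \<in> I. A \<in> B j}"
    using fin card_mono[of "I - {j \<in> I. A \<in> B j}" ?bad] by (simp add: card_Diff_subset)
  moreover have "card {j \<in> I. A \<in> B j} \<le> card I" using fin by (intro card_mono) auto
  ultimately have "real (card ?bad) \<le> card I - p * card I" using A(2) by linarith
  then have "(\<Sum>x | length x = m. real (card (mispredictions (g (f x)) x))) \<le> ((1 - p) * m) * 2 ^ m"
    using fin by (simp add: card X_def[symmetric] algebra_simps)
  then have bound: "2 ^ m * exp (- u * ((1 - p) * m)) \<le> card (memory \<Sigma> s) * (1 + exp (- u)) ^ m"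
    using augmented_indexing_bound[of "memory \<Sigma> s" m f u g] f finite_memory assms by fastforce
  have "card \<Sigma> > 0" using assms by (auto simp: card_gt_0_iff)
  have pos: "1 + exp (- u) > 0" by (simp add: add_pos_pos)
  have "ln (2 ^ m * exp (- u * ((1 - p) * m))) \<le> ln (card (memory \<Sigma> s) * (1 + exp (- u)) ^ m)"
    using bound by (intro ln_mono) auto
  then have "m * ln 2 - u * ((1 - p) * m) \<le> s * ln (card \<Sigma>) + m * ln (1 + exp (- u))"
    using \<open>card \<Sigma> > 0\<close> pos assms(1) by (simp add: ln_mult_pos ln_realpow card_memory)
  then show ?thesis by (simp add: algebra_simps)
qed

section \<open>Choice of parameters\<close>

theorem theorem4:
  fixes \<Sigma> :: "nat set" and p :: real
  assumes "finite \<Sigma>" and "card \<Sigma> \<ge> 2" and "p > 1 / 2"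
  shows "\<exists>c>0. \<exists>K. \<forall>(n::nat) (\<epsilon>::real) (s::nat) R.
    n > 0 \<and> \<epsilon> \<ge> 1 / sqrt (real n) \<and> sqrt (real n) / \<epsilon> \<ge> K \<and>
    randomized_alg \<Sigma> s R \<and> approximates_lps \<Sigma> n (\<epsilon> * sqrt (real n)) p R \<longrightarrow>
    real s \<ge> c * (sqrt (real n) / \<epsilon>)"
proof -
  obtain a b where ab: "a \<in> \<Sigma>" "b \<in> \<Sigma>" "a \<noteq> b"
    using assms(2) card_le_Suc0_iff_eq[OF assms(1)] by force
  obtain u where u: "u > 0" and rate: "0 < ln 2 - ln (1 + exp (- u)) - u * (1 - p)" (is "0 < ?r")
    using ex_positive_rate[OF assms(3)] by blast
  have ln: "ln (card \<Sigma>) > 0" using assms(2) by simp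
  define c where "c = ?r / (16 * ln (card \<Sigma>))"
  have "c > 0" using rate ln by (simp add: c_def)
  moreover have "c * (sqrt n / \<epsilon>) \<le> s"
    if n: "n > 0" and \<epsilon>: "\<epsilon> \<ge> 1 / sqrt (real n)" and K: "sqrt (real n) / \<epsilon> \<ge> 32"
      and R: "randomized_alg \<Sigma> s R" "approximates_lps \<Sigma> n (\<epsilon> * sqrt (real n)) p R" for n \<epsilon> s R
  proof -
    define E where "E = \<epsilon> * sqrt n"
    have E: "E \<ge> 1" using \<epsilon> n by (simp add: E_def field_simps)
    have "n / E = n / sqrt n / \<epsilon>" by (simp add: E_def mult.commute)
    then have q: "sqrt n / \<epsilon> = n / E" by (simp only: real_div_sqrt of_nat_0_le_iff)
    \<comment> \<open>The least block length exceeding \<open>E\<close>; \<open>E \<ge> 1\<close>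
      keeps it below \<open>2 * E\<close>, up to equality.\<close>
    define L where "L = Suc (nat \<lfloor>E\<rfloor>)"
    have L: "E < L" "L \<le> 2 * E" using E by (auto simp: L_def) linarith+
    have nE: "n \<ge> 32 * E" using K E by (simp add: q field_simps)
    then have "n \<ge> 32" using E by linarith
    \<comment> \<open>The largest \<open>m\<close> with
      \<open>4 * Suc (m * L) \<le> n\<close>.\<close>
    define m where "m = (n div 4 - 1) div L"
    have "m * L \<le> n div 4 - 1" by (simp add: m_def)
    then have "Suc (m * L) \<le> n div 4" using \<open>n \<ge> 32\<close> by linarith
    then have "4 * Suc (m * L) \<le> n" by (metis mult_le_mono2 le_trans times_div_less_eq_dividend)
    from cells_lower_bound[OF assms(1) ab _ u L(1) this R(1)] R(2) assms(3)
    have s: "m * ?r \<le> s * ln (card \<Sigma>)" by (simp add: E_def)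
    have "n div 4 - 1 < (m + 1) * L"
      using dividend_less_div_times[of L "n div 4 - 1"] by (simp add: m_def L_def)
    then have "n < 4 * ((m + 1) * L) + 8" by linarith
    then have "real n < real (4 * ((m + 1) * L) + 8)" by (simp only: of_nat_less_iff)
    also have "\<dots> = 4 * ((m + 1) * real L) + 8" by (simp add: algebra_simps)
    also have "\<dots> \<le> 4 * ((m + 1) * (2 * E)) + 8 * E"
      using L E by (intro add_mono mult_left_mono) auto
    \<comment> \<open>The sum is \<open>8 * m * E + 16 * E\<close>, and
      \<open>32 * E \<le> n\<close> bounds the second term by half of \<open>n\<close>. This
      explains both 32 and the 16 in \<open>c\<close>.\<close>
    finally have "n \<le> 16 * m * E" using nE by (simp add: algebra_simps)
    then have "n / E \<le> 16 * m" using E by (simp add: field_simps)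
    then have "c * (n / E) \<le> c * (16 * m)" using \<open>c > 0\<close> by (intro mult_left_mono) auto
    also have "\<dots> = m * ?r / ln (card \<Sigma>)" by (simp add: c_def)
    also have "\<dots> \<le> s" using s ln by (simp add: field_simps)
    finally show ?thesis by (simp add: q)
  qed
  ultimately show ?thesis by blast
qed

end
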